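(* Let $\alpha,\beta>0$ with $\alpha\beta=\pi^2$, let $k$ be a non-negative integer, and define for $\gamma>0$ $$J_k(\gamma):=\gamma^{-1/4}\,{}_2F_1\left(-2k-1,1;\frac32;2\right)+4\gamma^{3/4}\int_{0}^{\infty}\frac{xe^{-\gamma x^2}}{e^{2\pi x}-1}\,{}_1F_1\left(-2k-1;\frac32;2\gamma x^2\right)dx.$$ Then $J_k(\alpha)=-J_k(\beta)$.
   Context: ${}_2F_1$ is the Gauss hypergeometric function (here terminating) and ${}_1F_1$ is Kummer's confluent hypergeometric function. *)

theory Defs
  imports "HOL-Analysis.Analysis"
begin

text \<open>
  Where the power series diverges, these two functions do not denote the analytic continuation.
  If an upper parameter is a non-positive integer (and the lower parameter is not), the series
  terminates, so they then agree with the usual polynomial functions at every argument; this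
  covers \<open>\<^sub>2F\<^sub>1(-2k-1, 1; 3/2; 2)\<close>, whose argument lies outside the unit disc.
\<close>

definition hyp2F1 :: "real \<Rightarrow> real \<Rightarrow> real \<Rightarrow> real \<Rightarrow> real" where
  "hyp2F1 a b c z = eval_fps (fps_hypergeo [a, b] [c] 1) z"

definition hyp1F1 :: "real \<Rightarrow> real \<Rightarrow> real \<Rightarrow> real" where
  "hyp1F1 a c z = eval_fps (fps_hypergeo [a] [c] 1) z"

lemma hyp2F1_altdef:
  "hyp2F1 a b c z = (\<Sum>n. pochhammer a n * pochhammer b n / (pochhammer c n * fact n) * z ^ n)"
  by (simp add: hyp2F1_def eval_fps_def)

lemma hyp1F1_altdef:
  "hyp1F1 a c z = (\<Sum>n. pochhammer a n / (pochhammer c n * fact n) * z ^ n)"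
  by (simp add: hyp1F1_def eval_fps_def)

definition J :: "nat \<Rightarrow> real \<Rightarrow> real" where
  "J k \<gamma> =
     \<gamma> powr (- 1 / 4) * hyp2F1 (- 2 * real k - 1) 1 (3 / 2) 2
     + 4 * \<gamma> powr (3 / 4) *
       (LINT x:{0<..}|lborel.
          x * exp (- \<gamma> * x\<^sup>2) / (exp (2 * pi * x) - 1)
          * hyp1F1 (- 2 * real k - 1) (3 / 2) (2 * \<gamma> * x\<^sup>2))"

end

theory Submission
  imports
    Defs
    "HOL-Probability.Distributions"
    "HOL-Complex_Analysis.Complex_Analysis"
begin

text \<open>
  Write \<open>F(\<gamma>)\<close> for the integral of \<open>x exp(-\<gamma> x\<^sup>2) / (exp(2\<pi>x) - 1)\<close> over the half-line and
  \<open>S(\<gamma>) = F(\<gamma>) + 1/(4\<gamma>)\<close>.  Expanding \<open>1/(exp(2\<pi>x) - 1)\<close> once by partial fractions and once as a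
  geometric series, and comparing the two expansions term by term, gives
  \<open>S(\<alpha>) = \<beta> / sqrt(\<pi>\<alpha>) S(\<beta>)\<close> for \<open>\<alpha>\<beta> = \<pi>\<^sup>2\<close>.  Let \<open>J\<^sub>n\<close> denote the expression \<open>J\<close> with \<open>2k+1\<close>
  replaced by \<open>n\<close>.  By the generating function of the Laguerre polynomials,
  \<open>J\<^sub>n(\<gamma>) / (4\<gamma>\<^bsup>3/4\<^esup>)\<close> is, up to the factor \<open>(3/2)\<^sub>n / n!\<close>, the \<open>n\<close>-th Taylor coefficient at
  \<open>t = 0\<close> of \<open>(1-t)\<^bsup>-3/2\<^esup> S(\<gamma> (1+t)/(1-t))\<close>.  Since \<open>\<alpha> (1+t)/(1-t)\<close> and \<open>\<beta> (1-t)/(1+t)\<close>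
  again have product \<open>\<pi>\<^sup>2\<close>, exchanging \<open>\<alpha>\<close> and \<open>\<beta>\<close> amounts to \<open>t \<mapsto> -t\<close>, which produces the sign \<open>(-1)\<^sup>n\<close>.
\<close>

subsection \<open>Partial fractions of the kernel\<close>

text \<open>Euler's sine product at the imaginary point \<open>\<i> * x\<close>: squaring
  \<open>\<i>\<close> turns each factor \<open>1 - z^2 / k^2\<close> into
  \<open>1 + x^2 / k^2\<close>.\<close>

lemma sinh_product_formula_real:
  fixes x :: real
  assumes "x > 0"
  shows "(\<lambda>n. \<Prod>k=1..n. 1 + x\<^sup>2 / (real k)\<^sup>2) \<longlonglongrightarrow> sinh (pi * x) / (pi * x)"
proof -
  have "(\<lambda>n. of_real pi * (\<i> * of_real x) * (\<Prod>k=1..n. 1 - (\<i> * of_real x)^2 / of_nat k^2))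
          \<longlonglongrightarrow> sin (of_real pi * (\<i> * of_real x))"
    by (rule sin_product_formula_complex)
  also have "sin (of_real pi * (\<i> * of_real x)) = \<i> * of_real (sinh (pi * x))"
  proof -
    have "sin (of_real pi * (\<i> * of_real x)) = sin (\<i> * of_real (pi * x))"
      by (simp add: mult_ac)
    also have "\<dots> = \<i> * of_real (sinh (pi * x))"
      unfolding sin_i_times by (simp add: sinh_field_def exp_minus flip: exp_of_real)
    finally show ?thesis .
  qed
  also have "(\<lambda>n. of_real pi * (\<i> * of_real x) * (\<Prod>k=1..n. 1 - (\<i> * of_real x)^2 / of_nat k^2)) =
      (\<lambda>n. \<i> * of_real (pi * x * (\<Prod>k=1..n. 1 + x\<^sup>2 / (real k)\<^sup>2)))"
    by (simp add: power_mult_distrib mult_ac)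
  finally have "(\<lambda>n. complex_of_real (pi * x * (\<Prod>k=1..n. 1 + x\<^sup>2 / (real k)\<^sup>2)))
      \<longlonglongrightarrow> of_real (sinh (pi * x))"
    by (subst (asm) tendsto_mult_left_iff) auto
  hence "(\<lambda>n. pi * x * (\<Prod>k=1..n. 1 + x\<^sup>2 / (real k)\<^sup>2)) \<longlonglongrightarrow> sinh (pi * x)"
    by (subst (asm) tendsto_of_real_iff)
  from tendsto_divide[OF this tendsto_const[of "pi * x"]] assms show ?thesis by simp
qed

lemma ln_sinh_series:
  fixes x :: real
  assumes "x > 0"
  shows "(\<lambda>k. ln (1 + x\<^sup>2 / (real (Suc k))\<^sup>2)) sums ln (sinh (pi * x) / (pi * x))"
proof -
  have pos: "1 + x\<^sup>2 / (real k)\<^sup>2 > 0" for k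
    by (meson add_pos_nonneg divide_nonneg_nonneg zero_le_power2 zero_less_one)
  have "(\<lambda>n. ln (\<Prod>k=1..n. 1 + x\<^sup>2 / (real k)\<^sup>2)) \<longlonglongrightarrow> ln (sinh (pi * x) / (pi * x))"
    using assms by (intro tendsto_ln sinh_product_formula_real) auto
  also have "(\<lambda>n. ln (\<Prod>k=1..n. 1 + x\<^sup>2 / (real k)\<^sup>2)) = (\<lambda>n. \<Sum>k<n. ln (1 + x\<^sup>2 / (real (Suc k))\<^sup>2))"
  proof
    fix n
    have "ln (\<Prod>k=1..n. 1 + x\<^sup>2 / (real k)\<^sup>2) = (\<Sum>k=1..n. ln (1 + x\<^sup>2 / (real k)\<^sup>2))"
      by (rule ln_prod) (use pos in \<open>simp_all add: less_imp_neq[THEN not_sym]\<close>)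
    also have "\<dots> = (\<Sum>k<n. ln (1 + x\<^sup>2 / (real (Suc k))\<^sup>2))"
      by (rule sum.reindex_bij_witness[of _ Suc "\<lambda>k. k - 1"]) auto
    finally show "ln (\<Prod>k=1..n. 1 + x\<^sup>2 / (real k)\<^sup>2) = \<dots>" .
  qed
  finally show ?thesis by (simp add: sums_def)
qed

text \<open>Logarithmic derivative of the product for sinh. Termwise differentiation is justified by
  the Weierstrass M-test on \<open>S\<close>, whose upper end \<open>x + 1\<close> makes the
  majorant \<open>2 * (x + 1) / (k + 1)^2\<close> independent of the point.\<close>

lemma coth_partial_fractions:
  fixes x :: real
  assumes "x > 0"
  shows "(\<lambda>k. 2 * x / (x\<^sup>2 + (real (Suc k))\<^sup>2)) sums (pi * cosh (pi * x) / sinh (pi * x) - 1 / x)"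
proof -
  define f where "f = (\<lambda>k x. ln (1 + x\<^sup>2 / (real (Suc k))\<^sup>2))"
  define f' where "f' = (\<lambda>k x. 2 * x / (x\<^sup>2 + (real (Suc k))\<^sup>2))"
  define S where "S = {0<..<x + 1}"
  have deriv: "(f k has_field_derivative f' k y) (at y within S)" for k y
  proof -
    define N where "N = real (Suc k)"
    have "N > 0" by (simp add: N_def)
    moreover have "1 + y\<^sup>2 / N\<^sup>2 > 0"
      by (meson add_pos_nonneg divide_nonneg_nonneg zero_le_power2 zero_less_one)
    moreover have "y\<^sup>2 + N\<^sup>2 > 0"
      using \<open>N > 0\<close> by (intro add_nonneg_pos) auto
    moreover have "inverse (1 + y\<^sup>2 / N\<^sup>2) * (2 * y / N\<^sup>2) = 2 * y / (y\<^sup>2 + N\<^sup>2)"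
      using calculation by (simp add: divide_simps)
    moreover have "((\<lambda>y. 1 + y\<^sup>2 / N\<^sup>2) has_field_derivative 2 * y / N\<^sup>2) (at y within S)"
      using \<open>N > 0\<close> by (auto intro!: derivative_eq_intros simp: power2_eq_square)
    ultimately show ?thesis unfolding f_def f'_def N_def[symmetric]
      by (metis DERIV_chain2 DERIV_ln)
  qed
  have le: "norm (f' k y) \<le> 2 * (x + 1) * (1 / (real (Suc k))\<^sup>2)" if "y \<in> S" for k y
  proof -
    have "norm (f' k y) = 2 * y / (y\<^sup>2 + (real (Suc k))\<^sup>2)"
      using that by (simp add: f'_def S_def)
    also have "\<dots> \<le> 2 * (x + 1) / (real (Suc k))\<^sup>2"
      using that by (intro frac_le) (auto simp: S_def)
    finally show ?thesis by simp
  qed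
  have "summable (\<lambda>k. 1 / (real (Suc k))\<^sup>2)"
    using inverse_squares_sums by (simp add: sums_iff add.commute)
  hence unif: "uniformly_convergent_on S (\<lambda>n y. \<Sum>i<n. f' i y)"
    by (intro Weierstrass_m_test'[OF le] summable_mult)
  have sums: "(\<lambda>k. f k y) sums ln (sinh (pi * y) / (pi * y))" if "y > 0" for y
    unfolding f_def using ln_sinh_series[OF that] .
  have "((\<lambda>y. \<Sum>k. f k y) has_field_derivative (\<Sum>k. f' k x)) (at x)"
    by (rule has_field_derivative_series'[OF _ deriv unif])
       (use assms sums in \<open>auto simp: S_def sums_iff\<close>)
  also have "?this \<longleftrightarrow> ((\<lambda>y. ln (sinh (pi * y) / (pi * y))) has_field_derivative (\<Sum>k. f' k x)) (at x)"
  proof (rule DERIV_cong_ev)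
    have "eventually (\<lambda>y. y > 0) (nhds x)"
      using assms by (intro eventually_nhds_in_open[of "{0<..}", simplified]) auto
    thus "\<forall>\<^sub>F y in nhds x. (\<Sum>k. f k y) = ln (sinh (pi * y) / (pi * y))"
      by eventually_elim (use sums in \<open>auto simp: sums_iff\<close>)
  qed auto
  finally have "((\<lambda>y. ln (sinh (pi * y) / (pi * y))) has_field_derivative (\<Sum>k. f' k x)) (at x)" .
  moreover have "((\<lambda>y. ln (sinh (pi * y) / (pi * y))) has_field_derivative
      (pi * cosh (pi * x) / sinh (pi * x) - 1 / x)) (at x)"
  proof -
    have "sinh (pi * x) > 0" using assms by simp
    with assms show ?thesis
      by (auto intro!: derivative_eq_intros) (auto simp: field_simps)
  qed
  ultimately have "(\<Sum>k. f' k x) = pi * cosh (pi * x) / sinh (pi * x) - 1 / x"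
    by (rule DERIV_unique)
  moreover have "summable (\<lambda>k. f' k x)"
    by (rule summable_comparison_test'[OF summable_mult[OF \<open>summable (\<lambda>k. 1 / (real (Suc k))\<^sup>2)\<close>,
        of "2 * (x + 1)"], of 0])
       (rule le, use assms in \<open>simp add: S_def\<close>)
  ultimately show ?thesis by (simp add: f'_def sums_iff)
qed

text \<open>The coth expansion times \<open>x / (2 * pi)\<close>, using
  \<open>coth (pi * x) = 1 + 2 / (exp (2 * pi * x) - 1)\<close>. After Gaussian integration the two
  elementary terms become the corrections \<open>1 / (4 * a^2)\<close> and
  \<open>1 / (4 * sqrt pi * a)\<close>.\<close>

lemma bose_kernel_partial_fractions:
  fixes x :: real
  assumes "x > 0"
  shows "(\<lambda>k. x\<^sup>2 / (x\<^sup>2 + (real (Suc k))\<^sup>2) / pi) sums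
           (x / (exp (2 * pi * x) - 1) + x / 2 - 1 / (2 * pi))"
proof -
  have "(\<lambda>k. x / (2 * pi) * (2 * x / (x\<^sup>2 + (real (Suc k))\<^sup>2))) sums
          (x / (2 * pi) * (pi * cosh (pi * x) / sinh (pi * x) - 1 / x))"
    by (intro sums_mult coth_partial_fractions assms)
  also have "x / (2 * pi) * (pi * cosh (pi * x) / sinh (pi * x) - 1 / x) =
      x / (exp (2 * pi * x) - 1) + x / 2 - 1 / (2 * pi)"
  proof -
    define E where "E = exp (pi * x)"
    have E: "E > 1" "exp (2 * pi * x) = E * E" "exp (- (pi * x)) = 1 / E"
      using assms by (auto simp: E_def exp_minus field_simps simp flip: exp_add)
    have "E * E > 1" using E(1) by (metis less_1_mult)
    thus ?thesis using assms E(1) unfolding cosh_def sinh_def E(2,3) E_def[symmetric]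
      by (simp add: field_simps)
  qed
  finally show ?thesis by (simp add: power2_eq_square mult_ac)
qed

subsection \<open>Gaussian integrals\<close>

text \<open>The even moments of \<open>exp (- x^2)\<close>, rescaled by \<open>sqrt c\<close>. The
  cases \<open>k = 0\<close> and \<open>k = 1\<close> supply explicit values below; general
  \<open>k\<close> gives integrability of the moments.\<close>

lemma nn_integral_gaussian_halfline:
  fixes c :: real
  assumes "c > 0"
  shows "(\<integral>\<^sup>+x\<in>{0..}. ennreal (exp (- c * x\<^sup>2) * x ^ (2 * k)) \<partial>lborel) =
    ennreal (sqrt pi / 2 * (fact (2 * k) / (2 ^ (2 * k) * fact k)) / (sqrt c) ^ (2 * k + 1))"
proof -
  define I where "I = sqrt pi / 2 * (fact (2 * k) / (2 ^ (2 * k) * fact k))"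
  have I0: "I \<ge> 0" by (simp add: I_def)
  have c': "sqrt c > 0" using assms by simp
  have "ennreal I = (\<integral>\<^sup>+x. ennreal (indicator {0..} x * (exp (- x\<^sup>2) * x ^ (2 * k))) \<partial>lborel)"
    using gaussian_moment_even_pos[of k] unfolding I_def
    by (subst nn_integral_eq_integral) (auto simp: has_bochner_integral_iff)
  also have "\<dots> = \<bar>sqrt c\<bar> * (\<integral>\<^sup>+x. ennreal (indicator {0..} (0 + sqrt c * x) *
      (exp (- (0 + sqrt c * x)\<^sup>2) * (0 + sqrt c * x) ^ (2 * k))) \<partial>lborel)"
    using c' by (intro nn_integral_real_affine) auto
  also have "(\<integral>\<^sup>+x. ennreal (indicator {0..} (0 + sqrt c * x) *
      (exp (- (0 + sqrt c * x)\<^sup>2) * (0 + sqrt c * x) ^ (2 * k))) \<partial>lborel) =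
    (\<integral>\<^sup>+x. ennreal (sqrt c ^ (2 * k)) *
        (ennreal (exp (- c * x\<^sup>2) * x ^ (2 * k)) * indicator {0..} x) \<partial>lborel)"
    using assms c' by (intro nn_integral_cong)
      (auto simp: indicator_def power_mult_distrib ennreal_mult[symmetric] zero_le_mult_iff mult_ac)
  also have "\<dots> =
      ennreal (sqrt c ^ (2 * k)) * (\<integral>\<^sup>+x\<in>{0..}. ennreal (exp (- c * x\<^sup>2) * x ^ (2 * k)) \<partial>lborel)"
    by (intro nn_integral_cmult) auto
  finally have "ennreal I = ennreal (sqrt c ^ (2 * k + 1)) *
      (\<integral>\<^sup>+x\<in>{0..}. ennreal (exp (- c * x\<^sup>2) * x ^ (2 * k)) \<partial>lborel)" (is "_ = _ * ?N")
    using c' by (simp add: mult.assoc[symmetric] ennreal_mult[symmetric])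
  hence "ennreal (1 / sqrt c ^ (2 * k + 1)) * ennreal I =
      ennreal (1 / sqrt c ^ (2 * k + 1)) * ennreal (sqrt c ^ (2 * k + 1)) * ?N"
    by (simp only: mult.assoc)
  also have "ennreal (1 / sqrt c ^ (2 * k + 1)) * ennreal (sqrt c ^ (2 * k + 1)) = 1"
    using c' by (subst ennreal_mult[symmetric]) (auto simp del: power_Suc)
  finally have "?N = ennreal (1 / sqrt c ^ (2 * k + 1)) * ennreal I" by simp
  also have "\<dots> = ennreal (I / sqrt c ^ (2 * k + 1))"
    using I0 c' by (subst ennreal_mult[symmetric]) auto
  finally show ?thesis by (simp add: I_def)
qed

text \<open>Turns the denominator \<open>x^2 + m^2\<close> into an exponential, so that
  \<open>x\<close> enters only through a Gaussian and can be integrated out first.\<close>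

lemma nn_integral_gaussian_kernel:
  fixes a m x :: real
  assumes "a > 0" "m > 0"
  shows "ennreal (exp (- (a\<^sup>2) * x\<^sup>2) / (x\<^sup>2 + m\<^sup>2)) =
    ennreal (exp (a\<^sup>2 * m\<^sup>2)) *
      (\<integral>\<^sup>+v\<in>{a..}. ennreal (2 * v * exp (- (v\<^sup>2) * (x\<^sup>2 + m\<^sup>2))) \<partial>lborel)"
proof -
  define D where "D = x\<^sup>2 + m\<^sup>2"
  have D: "D > 0" unfolding D_def using assms by (intro add_nonneg_pos) auto
  have "(\<integral>\<^sup>+v\<in>{a..}. ennreal (2 * v * exp (- (v\<^sup>2) * D)) \<partial>lborel) =
      ennreal (0 - (- exp (- (a\<^sup>2) * D) / D))"
  proof (rule nn_integral_FTC_atLeast)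
    show "((\<lambda>v. - exp (- (v\<^sup>2) * D) / D) \<longlongrightarrow> 0) at_top"
      using D by real_asymp
  qed (use D assms in \<open>auto intro!: derivative_eq_intros simp: field_simps\<close>)
  hence "ennreal (exp (a\<^sup>2 * m\<^sup>2)) * (\<integral>\<^sup>+v\<in>{a..}. ennreal (2 * v * exp (- (v\<^sup>2) * D)) \<partial>lborel) =
     ennreal (exp (a\<^sup>2 * m\<^sup>2) * (exp (- (a\<^sup>2) * D) / D))"
    using D by (simp add: ennreal_mult[symmetric])
  also have "exp (a\<^sup>2 * m\<^sup>2) * (exp (- (a\<^sup>2) * D) / D) = exp (- (a\<^sup>2) * x\<^sup>2) / D"
    by (simp add: D_def exp_add[symmetric] algebra_simps)
  finally show ?thesis by (simp add: D_def)
qed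

text \<open>The bridge between the two transforms below: the rational kernel leads to the left-hand
  integral, the exponential kernel to the right-hand one.\<close>

lemma nn_integral_gaussian_tail:
  fixes a m :: real
  assumes a: "a > 0" and m: "m > 0"
  shows "(\<integral>\<^sup>+v\<in>{a..}. ennreal (exp (- (m\<^sup>2) * v\<^sup>2) / (2 * v\<^sup>2)) \<partial>lborel) =
         ennreal (m\<^sup>2 / a) * (\<integral>\<^sup>+v\<in>{a..}. ennreal ((v - a) * exp (- (m\<^sup>2) * v\<^sup>2)) \<partial>lborel)"
proof -
  let ?e = "\<lambda>v. exp (- (m\<^sup>2) * v\<^sup>2)"
  let ?N = "\<lambda>f. \<integral>\<^sup>+v\<in>{a..}. ennreal (f v) \<partial>lborel"
  \<comment> \<open>Adding \<open>m\<^sup>2 exp(-m\<^sup>2 v\<^sup>2)\<close> turns either integrand into an exact derivative.\<close>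
  have 1: "?N (\<lambda>v. (1 / (2 * v\<^sup>2) + m\<^sup>2) * ?e v) = ennreal (0 - (- ?e a / (2 * a)))"
  proof (rule nn_integral_FTC_atLeast)
    show "((\<lambda>v. - ?e v / (2 * v)) \<longlongrightarrow> 0) at_top"
      using m by real_asymp
    fix v assume "a \<le> v"
    hence "v > 0" using a by simp
    thus "((\<lambda>v. - ?e v / (2 * v)) has_real_derivative (1 / (2 * v\<^sup>2) + m\<^sup>2) * ?e v) (at v)"
      by (auto intro!: derivative_eq_intros simp: field_simps power2_eq_square)
  qed auto
  have 2: "?N (\<lambda>v. m\<^sup>2 * v / a * ?e v) = ennreal (0 - (- ?e a / (2 * a)))"
  proof (rule nn_integral_FTC_atLeast[where F = "\<lambda>v. - ?e v / (2 * a)"])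
    show "((\<lambda>v. - ?e v / (2 * a)) \<longlongrightarrow> 0) at_top"
      using m a by real_asymp
    fix v assume "a \<le> v"
    hence "v > 0" using a by simp
    thus "((\<lambda>v. - ?e v / (2 * a)) has_real_derivative m\<^sup>2 * v / a * ?e v) (at v)"
      using a by (auto intro!: derivative_eq_intros simp: field_simps power2_eq_square)
    show "0 \<le> m\<^sup>2 * v / a * ?e v" using a \<open>v > 0\<close> by simp
  qed auto
  define P where "P = ?N (\<lambda>v. m\<^sup>2 * ?e v)"
  have "?N (\<lambda>v. (1 / (2 * v\<^sup>2) + m\<^sup>2) * ?e v) =
      (\<integral>\<^sup>+v. ennreal (?e v / (2 * v\<^sup>2)) * indicator {a..} v +
          ennreal (m\<^sup>2 * ?e v) * indicator {a..} v \<partial>lborel)"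
    by (intro nn_integral_cong)
        (auto simp: indicator_def ennreal_plus[symmetric] algebra_simps simp del: ennreal_plus)
  also have "\<dots> = ?N (\<lambda>v. ?e v / (2 * v\<^sup>2)) + P"
    unfolding P_def by (intro nn_integral_add) auto
  finally have 3: "?N (\<lambda>v. ?e v / (2 * v\<^sup>2)) + P = ennreal (0 - (- ?e a / (2 * a)))" using 1 by simp
  have "?N (\<lambda>v. m\<^sup>2 * v / a * ?e v) =
      (\<integral>\<^sup>+v. ennreal (m\<^sup>2 / a) * (ennreal ((v - a) * ?e v) * indicator {a..} v) +
          ennreal (m\<^sup>2 * ?e v) * indicator {a..} v \<partial>lborel)"
  proof (intro nn_integral_cong)
    fix v :: real
    have "m\<^sup>2 * v / a * ?e v = m\<^sup>2 / a * ((v - a) * ?e v) + m\<^sup>2 * ?e v"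
      using a by (simp add: field_simps)
    hence "ennreal (m\<^sup>2 * v / a * ?e v) = ennreal (m\<^sup>2 / a) * ennreal ((v - a) * ?e v) +
        ennreal (m\<^sup>2 * ?e v)" if "a \<le> v"
      using a that by (simp only: ennreal_plus ennreal_mult mult_nonneg_nonneg divide_nonneg_pos
          zero_le_power2 exp_ge_zero diff_ge_0_iff_ge)
    thus "ennreal (m\<^sup>2 * v / a * ?e v) * indicator {a..} v =
        ennreal (m\<^sup>2 / a) * (ennreal ((v - a) * ?e v) * indicator {a..} v) +
            ennreal (m\<^sup>2 * ?e v) * indicator {a..} v"
      by (cases "a \<le> v") simp_all
  qed
  also have "\<dots> = ennreal (m\<^sup>2 / a) * ?N (\<lambda>v. (v - a) * ?e v) + P"
    unfolding P_def by (subst nn_integral_add) (auto intro!: nn_integral_cmult)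
  finally have 4: "ennreal (m\<^sup>2 / a) * ?N (\<lambda>v. (v - a) * ?e v) + P =
      ennreal (0 - (- ?e a / (2 * a)))" using 2 by simp
  \<comment> \<open>Cancelling \<open>P\<close> in the extended nonnegative reals requires it to be
    finite; equation \<open>3\<close> bounds it by a finite value.\<close>
  have "P \<noteq> top"
  proof
    assume "P = top"
    with 3 show False by simp
  qed
  moreover have "P + ?N (\<lambda>v. ?e v / (2 * v\<^sup>2)) = P + ennreal (m\<^sup>2 / a) * ?N (\<lambda>v. (v - a) * ?e v)"
    using 3 4 by (simp only: add.commute)
  ultimately show ?thesis
    unfolding ennreal_add_left_cancel by (elim disjE) simp_all
qed

text \<open>Insert the kernel representation and exchange the integrals by Tonelli. The inner
  integral is a second Gaussian moment, \<open>sqrt pi / (4 * v^3)\<close>, and the weight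
  \<open>2 * v\<close> reduces it to \<open>sqrt pi / (2 * v^2)\<close>.\<close>

lemma nn_integral_gaussian_over_square_sum:
  fixes a m :: real
  assumes a: "a > 0" and m: "m > 0"
  shows "(\<integral>\<^sup>+x\<in>{0..}. ennreal (x\<^sup>2 * exp (- (a\<^sup>2) * x\<^sup>2) / (x\<^sup>2 + m\<^sup>2)) \<partial>lborel) =
         ennreal (sqrt pi * exp (a\<^sup>2 * m\<^sup>2)) *
           (\<integral>\<^sup>+v\<in>{a..}. ennreal (exp (- (m\<^sup>2) * v\<^sup>2) / (2 * v\<^sup>2)) \<partial>lborel)"
proof -
  let ?C = "ennreal (exp (a\<^sup>2 * m\<^sup>2))"
  let ?h = "\<lambda>x v. ennreal (2 * v * exp (- (v\<^sup>2) * m\<^sup>2)) * indicator {a..} v *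
      (ennreal (exp (- (v\<^sup>2) * x\<^sup>2) * x\<^sup>2) * indicator {0..} x)"
  have "(\<integral>\<^sup>+x\<in>{0..}. ennreal (x\<^sup>2 * exp (- (a\<^sup>2) * x\<^sup>2) / (x\<^sup>2 + m\<^sup>2)) \<partial>lborel) =
     (\<integral>\<^sup>+x. ?C * (\<integral>\<^sup>+v. ?h x v \<partial>lborel) \<partial>lborel)"
  proof (intro nn_integral_cong)
    fix x :: real
    have "ennreal (x\<^sup>2 * exp (- (a\<^sup>2) * x\<^sup>2) / (x\<^sup>2 + m\<^sup>2)) * indicator {0..} x =
       ennreal (exp (- (a\<^sup>2) * x\<^sup>2) / (x\<^sup>2 + m\<^sup>2)) * (ennreal (x\<^sup>2) * indicator {0..} x)"
      by (auto simp: indicator_def ennreal_mult[symmetric] mult_ac)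
    also have "\<dots> =
        ?C * ((\<integral>\<^sup>+v\<in>{a..}. ennreal (2 * v * exp (- (v\<^sup>2) * (x\<^sup>2 + m\<^sup>2))) \<partial>lborel) *
            (ennreal (x\<^sup>2) * indicator {0..} x))"
      by (subst nn_integral_gaussian_kernel[OF a m]) (simp only: mult.assoc)
    also have "(\<integral>\<^sup>+v\<in>{a..}. ennreal (2 * v * exp (- (v\<^sup>2) * (x\<^sup>2 + m\<^sup>2))) \<partial>lborel) *
        (ennreal (x\<^sup>2) * indicator {0..} x) =
      (\<integral>\<^sup>+v. ennreal (2 * v * exp (- (v\<^sup>2) * (x\<^sup>2 + m\<^sup>2))) * indicator {a..} v *
          (ennreal (x\<^sup>2) * indicator {0..} x) \<partial>lborel)"
      by (rule nn_integral_multc[symmetric]) auto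
    also have "\<dots> = (\<integral>\<^sup>+v. ?h x v \<partial>lborel)"
      using a by (intro nn_integral_cong)
        (auto simp: indicator_def ennreal_mult[symmetric] exp_add[symmetric] algebra_simps)
    finally show "ennreal (x\<^sup>2 * exp (- (a\<^sup>2) * x\<^sup>2) / (x\<^sup>2 + m\<^sup>2)) * indicator {0..} x =
        ?C * (\<integral>\<^sup>+v. ?h x v \<partial>lborel)" .
  qed
  also have "\<dots> = ?C * (\<integral>\<^sup>+x. \<integral>\<^sup>+v. ?h x v \<partial>lborel \<partial>lborel)"
    by (intro nn_integral_cmult) measurable
  also have "(\<integral>\<^sup>+x. \<integral>\<^sup>+v. ?h x v \<partial>lborel \<partial>lborel) = (\<integral>\<^sup>+v. \<integral>\<^sup>+x. ?h x v \<partial>lborel \<partial>lborel)"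
    by (rule lborel_pair.Fubini') measurable
  also have "\<dots> =
      (\<integral>\<^sup>+v. ennreal (sqrt pi) * (ennreal (exp (- (m\<^sup>2) * v\<^sup>2) / (2 * v\<^sup>2)) * indicator {a..} v)
          \<partial>lborel)"
  proof (intro nn_integral_cong)
    fix v :: real
    show "(\<integral>\<^sup>+x. ?h x v \<partial>lborel) =
        ennreal (sqrt pi) * (ennreal (exp (- (m\<^sup>2) * v\<^sup>2) / (2 * v\<^sup>2)) * indicator {a..} v)"
    proof (cases "v \<ge> a")
      case True
      hence v: "v > 0" using a by simp
      have "(\<integral>\<^sup>+x. ?h x v \<partial>lborel) =
          ennreal (2 * v * exp (- (v\<^sup>2) * m\<^sup>2)) *
              (\<integral>\<^sup>+x\<in>{0..}. ennreal (exp (- (v\<^sup>2) * x\<^sup>2) * x\<^sup>2) \<partial>lborel)"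
        using True by (subst nn_integral_cmult) auto
      also have "(\<integral>\<^sup>+x\<in>{0..}. ennreal (exp (- (v\<^sup>2) * x\<^sup>2) * x\<^sup>2) \<partial>lborel) =
          ennreal (sqrt pi / (4 * v ^ 3))"
        using nn_integral_gaussian_halfline[of "v\<^sup>2" 1] v by (simp add: eval_nat_numeral)
      also have "ennreal (2 * v * exp (- (v\<^sup>2) * m\<^sup>2)) * \<dots> =
          ennreal (sqrt pi) * ennreal (exp (- (m\<^sup>2) * v\<^sup>2) / (2 * v\<^sup>2))"
        using v by (subst (1 2) ennreal_mult[symmetric]) (auto simp: field_simps eval_nat_numeral)
      finally show ?thesis using True by simp
    qed auto
  qed
  also have "\<dots> =
      ennreal (sqrt pi) * (\<integral>\<^sup>+v\<in>{a..}. ennreal (exp (- (m\<^sup>2) * v\<^sup>2) / (2 * v\<^sup>2)) \<partial>lborel)"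
    by (intro nn_integral_cmult) measurable
  finally show ?thesis by (simp add: ennreal_mult mult_ac)
qed

text \<open>Completing the square: with \<open>x = m / b * (v - a)\<close> and
  \<open>a * b = pi\<close>, the exponent \<open>- b^2 * x^2 - 2 * pi * m * x\<close> becomes
  \<open>a^2 * m^2 - m^2 * v^2\<close>.\<close>

lemma nn_integral_gaussian_exp:
  fixes a b m :: real
  assumes a: "a > 0" and b: "b > 0" and m: "m > 0" and ab: "a * b = pi"
  shows "(\<integral>\<^sup>+x\<in>{0..}. ennreal (x * exp (- (b\<^sup>2) * x\<^sup>2) * exp (- 2 * pi * m * x)) \<partial>lborel) =
         ennreal (m\<^sup>2 / b\<^sup>2 * exp (a\<^sup>2 * m\<^sup>2)) *
           (\<integral>\<^sup>+v\<in>{a..}. ennreal ((v - a) * exp (- (m\<^sup>2) * v\<^sup>2)) \<partial>lborel)"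
proof -
  let ?f = "\<lambda>x. ennreal (x * exp (- (b\<^sup>2) * x\<^sup>2) * exp (- 2 * pi * m * x)) * indicator {0..} x"
  have "(\<integral>\<^sup>+x. ?f x \<partial>lborel) = ennreal \<bar>m / b\<bar> * (\<integral>\<^sup>+v. ?f (- (m * a / b) + m / b * v) \<partial>lborel)"
    using b m by (intro nn_integral_real_affine) auto
  also have "(\<lambda>v. ?f (- (m * a / b) + m / b * v)) =
    (\<lambda>v. ennreal (m / b * exp (a\<^sup>2 * m\<^sup>2)) *
        (ennreal ((v - a) * exp (- (m\<^sup>2) * v\<^sup>2)) * indicator {a..} v))"
  proof
    fix v :: real
    have x: "- (m * a / b) + m / b * v = m / b * (v - a)"
      by (simp add: algebra_simps diff_divide_distrib)
    have "0 \<le> m / b * (v - a) \<longleftrightarrow> a \<le> v" using divide_pos_pos[OF m b] by (subst zero_le_mult_iff) auto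
    moreover have "exp (- (b\<^sup>2) * (m / b * (v - a))\<^sup>2) * exp (- 2 * pi * m * (m / b * (v - a))) =
        exp (a\<^sup>2 * m\<^sup>2) * exp (- (m\<^sup>2) * v\<^sup>2)"
      using b unfolding ab[symmetric] exp_add[symmetric]
      by (intro arg_cong[where f = exp]) (simp add: field_simps power2_eq_square)
    ultimately show "?f (- (m * a / b) + m / b * v) =
        ennreal (m / b * exp (a\<^sup>2 * m\<^sup>2)) *
            (ennreal ((v - a) * exp (- (m\<^sup>2) * v\<^sup>2)) * indicator {a..} v)"
      unfolding x using b m
      by (cases "a \<le> v") (auto simp: ennreal_mult[symmetric] mult.assoc mult.left_commute)
  qed
  also have "(\<integral>\<^sup>+v. \<dots> v \<partial>lborel) = ennreal (m / b * exp (a\<^sup>2 * m\<^sup>2)) *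
      (\<integral>\<^sup>+v\<in>{a..}. ennreal ((v - a) * exp (- (m\<^sup>2) * v\<^sup>2)) \<partial>lborel)"
    by (intro nn_integral_cmult) measurable
  finally show ?thesis using b m
    by (simp add: mult.assoc[symmetric] ennreal_mult[symmetric]) (simp add: power2_eq_square)
qed

text \<open>Matches one partial-fraction term at \<open>a\<close> with one geometric-series term at
  \<open>b\<close>. The proportionality factor does not depend on \<open>m\<close>, so the identity
  can be summed over \<open>m\<close>.\<close>

lemma nn_integral_gaussian_transform:
  fixes a b m :: real
  assumes a: "a > 0" and b: "b > 0" and m: "m > 0" and ab: "a * b = pi"
  shows "(\<integral>\<^sup>+x\<in>{0..}. ennreal (x\<^sup>2 * exp (- (a\<^sup>2) * x\<^sup>2) / (x\<^sup>2 + m\<^sup>2)) \<partial>lborel) =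
         ennreal (sqrt pi * b\<^sup>2 / a) *
           (\<integral>\<^sup>+x\<in>{0..}. ennreal (x * exp (- (b\<^sup>2) * x\<^sup>2) * exp (- 2 * pi * m * x)) \<partial>lborel)"
  unfolding nn_integral_gaussian_over_square_sum[OF a m] nn_integral_gaussian_exp[OF assms]
      nn_integral_gaussian_tail[OF a m]
  using a b by (simp add: mult.assoc[symmetric] ennreal_mult[symmetric]) (simp add: mult_ac)

subsection \<open>The reciprocity formula\<close>

text \<open>Extended by zero to the left half-line so that its moments are integrals over all of
  \<open>lborel\<close>.\<close>

definition bose_kernel :: "real \<Rightarrow> real" where
  "bose_kernel x = (if x > 0 then x / (exp (2 * pi * x) - 1) else 0)"

text \<open>For \<open>\<gamma> > 0\<close> this is, up to the sign \<open>(-1)^j\<close>, the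
  \<open>j\<close>-th derivative in \<open>\<gamma>\<close> of the moment of index 0.\<close>

definition bose_moment :: "real \<Rightarrow> nat \<Rightarrow> real" where
  "bose_moment \<gamma> j = (LINT x|lborel. bose_kernel x * exp (- \<gamma> * x\<^sup>2) * (x\<^sup>2) ^ j)"

lemma bose_kernel_nonneg [simp]: "bose_kernel x \<ge> 0"
  and bose_kernel_le: "bose_kernel x \<le> 1 / (2 * pi)"
proof -
  have *: "exp (2 * pi * x) - 1 \<ge> 2 * pi * x"
    using exp_ge_add_one_self[of "2 * pi * x"] by linarith
  moreover have "2 * pi * x > 0" if "x > 0"
    using that by simp
  ultimately have "exp (2 * pi * x) - 1 > 0" if "x > 0"
    using that by fastforce
  note * = * this
  show "bose_kernel x \<ge> 0" "bose_kernel x \<le> 1 / (2 * pi)"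
    unfolding bose_kernel_def using * by (auto simp: field_simps)
qed

lemma bose_kernel_measurable [measurable]: "bose_kernel \<in> borel_measurable borel"
  unfolding bose_kernel_def by measurable

text \<open>The kernel is at most \<open>1 / (2 * pi)\<close>, so a half-line Gaussian moment
  dominates.\<close>

lemma integrable_bose:
  assumes "\<gamma> > 0"
  shows "integrable lborel (\<lambda>x. bose_kernel x * exp (- \<gamma> * x\<^sup>2) * (x\<^sup>2) ^ j)"
proof -
  have "integrable lborel (\<lambda>x. indicator {0..} x * (exp (- \<gamma> * x\<^sup>2) * x ^ (2 * j)) :: real)"
  proof (rule integrableI_nonneg)
    have "(\<integral>\<^sup>+x. ennreal (indicator {0..} x * (exp (- \<gamma> * x\<^sup>2) * x ^ (2 * j))) \<partial>lborel) =
      (\<integral>\<^sup>+x\<in>{0..}. ennreal (exp (- \<gamma> * x\<^sup>2) * x ^ (2 * j)) \<partial>lborel)"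
      by (intro nn_integral_cong) (auto simp: indicator_def)
    also have "\<dots> < \<infinity>" by (subst nn_integral_gaussian_halfline[OF assms]) simp
    finally show "(\<integral>\<^sup>+x. ennreal (indicator {0..} x * (exp (- \<gamma> * x\<^sup>2) * x ^ (2 * j))) \<partial>lborel) <
        \<infinity>" .
  qed auto
  hence *: "integrable lborel (\<lambda>x. 1 / (2 * pi) *
      (indicator {0..} x * (exp (- \<gamma> * x\<^sup>2) * x ^ (2 * j))) :: real)"
    by (rule integrable_mult_right)
  have "norm (bose_kernel x * exp (- \<gamma> * x\<^sup>2) * (x\<^sup>2) ^ j) \<le>
      norm (1 / (2 * pi) * (indicator {0..} x * (exp (- \<gamma> * x\<^sup>2) * x ^ (2 * j))))" for x
  proof (cases "x > 0")
    case True
    have "bose_kernel x * (exp (- \<gamma> * x\<^sup>2) * (x\<^sup>2) ^ j) \<le>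
        1 / (2 * pi) * (exp (- \<gamma> * x\<^sup>2) * (x\<^sup>2) ^ j)"
      by (intro mult_right_mono bose_kernel_le) auto
    thus ?thesis using True by (simp add: abs_mult power_mult mult.assoc)
  qed (simp add: bose_kernel_def)
  thus ?thesis by (intro Bochner_Integration.integrable_bound[OF *]) auto
qed

lemma nn_integral_bose:
  assumes "\<gamma> > 0"
  shows "(\<integral>\<^sup>+x. ennreal (bose_kernel x * exp (- \<gamma> * x\<^sup>2)) \<partial>lborel) = ennreal (bose_moment \<gamma> 0)"
    and "bose_moment \<gamma> 0 \<ge> 0"
  using integrable_bose[OF assms, of 0] by (auto simp: bose_moment_def nn_integral_eq_integral)

text \<open>With \<open>q = exp (- 2 * pi * x)\<close> one has
  \<open>1 / (exp (2 * pi * x) - 1) = q / (1 - q)\<close>, hence exponents starting at 1. All terms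
  are nonnegative, so sum and integral commute.\<close>

lemma nn_integral_bose_geometric:
  fixes b :: real
  shows "(\<integral>\<^sup>+x. ennreal (bose_kernel x * exp (- (b\<^sup>2) * x\<^sup>2)) \<partial>lborel) =
    (\<Sum>k. \<integral>\<^sup>+x\<in>{0..}. ennreal (x * exp (- (b\<^sup>2) * x\<^sup>2) * exp (- 2 * pi * real (Suc k) * x)) \<partial>lborel)"
proof -
  have "(\<integral>\<^sup>+x. ennreal (bose_kernel x * exp (- (b\<^sup>2) * x\<^sup>2)) \<partial>lborel) =
    (\<integral>\<^sup>+x. (\<Sum>k. ennreal (x * exp (- (b\<^sup>2) * x\<^sup>2) * exp (- 2 * pi * real (Suc k) * x)) *
        indicator {0..} x) \<partial>lborel)"
  proof (intro nn_integral_cong)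
    fix x :: real
    consider "x < 0" | "x = 0" | "x > 0" by linarith
    thus "ennreal (bose_kernel x * exp (- (b\<^sup>2) * x\<^sup>2)) =
       (\<Sum>k. ennreal (x * exp (- (b\<^sup>2) * x\<^sup>2) * exp (- 2 * pi * real (Suc k) * x)) * indicator
           {0..} x)"
    proof cases
      case 3
      define q where "q = exp (- 2 * pi * x)"
      have q: "0 < q" "q < 1" using 3 by (auto simp: q_def)
      have "(\<lambda>k. x * exp (- (b\<^sup>2) * x\<^sup>2) * (q * q ^ k)) sums
          (x * exp (- (b\<^sup>2) * x\<^sup>2) * (q * (1 / (1 - q))))"
        using q by (intro sums_mult geometric_sums) auto
      also have "(\<lambda>k. q * q ^ k) = (\<lambda>k. exp (- 2 * pi * real (Suc k) * x))"
        by (simp add: q_def exp_of_nat_mult[symmetric] exp_add[symmetric] algebra_simps)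
      hence "(\<lambda>k. x * exp (- (b\<^sup>2) * x\<^sup>2) * (q * q ^ k)) =
          (\<lambda>k. x * exp (- (b\<^sup>2) * x\<^sup>2) * exp (- 2 * pi * real (Suc k) * x))"
        by (simp only: fun_eq_iff) simp
      also have "q * (1 / (1 - q)) = 1 / (exp (2 * pi * x) - 1)"
      proof -
        have "exp (2 * pi * x) = 1 / q" by (simp add: q_def exp_minus field_simps)
        thus ?thesis using q 3 by (simp add: divide_simps) (simp add: algebra_simps)
      qed
      finally have s: "(\<lambda>k. x * exp (- (b\<^sup>2) * x\<^sup>2) * exp (- 2 * pi * real (Suc k) * x)) sums
           (x * exp (- (b\<^sup>2) * x\<^sup>2) / (exp (2 * pi * x) - 1))" by simp
      have "(\<Sum>k. ennreal (x * exp (- (b\<^sup>2) * x\<^sup>2) * exp (- 2 * pi * real (Suc k) * x))) =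
         ennreal (\<Sum>k. x * exp (- (b\<^sup>2) * x\<^sup>2) * exp (- 2 * pi * real (Suc k) * x))"
        using 3 s by (intro suminf_ennreal2) (auto simp: sums_iff)
      also have "\<dots> = ennreal (x * exp (- (b\<^sup>2) * x\<^sup>2) / (exp (2 * pi * x) - 1))"
        using s by (simp add: sums_iff)
      finally show ?thesis using 3 by (simp add: bose_kernel_def)
    qed (auto simp: bose_kernel_def)
  qed
  also have "\<dots> =
      (\<Sum>k. \<integral>\<^sup>+x\<in>{0..}. ennreal (x * exp (- (b\<^sup>2) * x\<^sup>2) * exp (- 2 * pi * real (Suc k) * x))
          \<partial>lborel)"
    by (intro nn_integral_suminf) measurable
  finally show ?thesis .
qed

text \<open>Integrates the partial fractions against a Gaussian. The term from \<open>x / 2\<close>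
  is added on the left, and the one from \<open>1 / (2 * pi)\<close> on the right, so that no
  subtraction of extended reals occurs.\<close>

lemma nn_integral_bose_partial_fractions:
  fixes a :: real
  assumes a: "a > 0"
  shows "(\<integral>\<^sup>+x. ennreal (bose_kernel x * exp (- (a\<^sup>2) * x\<^sup>2)) \<partial>lborel) + ennreal (1 / (4 * a\<^sup>2)) =
    ennreal (1 / (4 * sqrt pi * a)) +
    (\<Sum>k. ennreal (1 / pi) *
        (\<integral>\<^sup>+x\<in>{0..}. ennreal (x\<^sup>2 * exp (- (a\<^sup>2) * x\<^sup>2) / (x\<^sup>2 + (real (Suc k))\<^sup>2)) \<partial>lborel))"
proof -
  let ?g = "\<lambda>x. exp (- (a\<^sup>2) * x\<^sup>2)"
  let ?I = "indicator {0..} :: real \<Rightarrow> ennreal"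
  have lin: "(\<integral>\<^sup>+x\<in>{0..}. ennreal (x * ?g x / 2) \<partial>lborel) = ennreal (0 - (- ?g 0 / (4 * a\<^sup>2)))"
  proof (rule nn_integral_FTC_atLeast)
    show "((\<lambda>x. - ?g x / (4 * a\<^sup>2)) \<longlongrightarrow> 0) at_top"
      using a by real_asymp
  qed (use a in \<open>auto intro!: derivative_eq_intros simp: field_simps\<close>)
  have gauss: "(\<integral>\<^sup>+x\<in>{0..}. ennreal (1 / (2 * pi)) * ennreal (?g x) \<partial>lborel) =
      ennreal (1 / (4 * sqrt pi * a))"
  proof -
    have "(\<integral>\<^sup>+x\<in>{0..}. ennreal (1 / (2 * pi)) * ennreal (?g x) \<partial>lborel) =
        ennreal (1 / (2 * pi)) * (\<integral>\<^sup>+x\<in>{0..}. ennreal (?g x) \<partial>lborel)"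
      by (simp add: mult.assoc nn_integral_cmult)
    also have "(\<integral>\<^sup>+x\<in>{0..}. ennreal (?g x) \<partial>lborel) = ennreal (sqrt pi / 2 / a)"
      using nn_integral_gaussian_halfline[of "a\<^sup>2" 0] a by simp
    also have "ennreal (1 / (2 * pi)) * \<dots> = ennreal (sqrt pi / (4 * pi * a))"
      using a by (simp add: ennreal_mult[symmetric])
    also have "sqrt pi / (4 * pi * a) = 1 / (4 * sqrt pi * a)"
      using a by (simp add: field_simps flip: power2_eq_square)
    finally show ?thesis .
  qed
  have "(\<integral>\<^sup>+x. ennreal (bose_kernel x * ?g x) \<partial>lborel) +
      (\<integral>\<^sup>+x. ennreal (x * ?g x / 2) * ?I x \<partial>lborel) =
        (\<integral>\<^sup>+x. ennreal (bose_kernel x * ?g x) + ennreal (x * ?g x / 2) * ?I x \<partial>lborel)"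
    by (intro nn_integral_add[symmetric]) measurable
  also have "\<dots> = (\<integral>\<^sup>+x. ennreal (1 / (2 * pi)) * ennreal (?g x) * ?I x +
      (\<Sum>k. ennreal (1 / pi) * (ennreal (x\<^sup>2 * ?g x / (x\<^sup>2 + (real (Suc k))\<^sup>2)) * ?I x)) \<partial>lborel)"
  \<comment> \<open>The pointwise identity fails at \<open>x = 0\<close>, where the left side is 0
    and the right side is \<open>1 / (2 * pi)\<close>.\<close>
  proof (rule nn_integral_cong_AE)
    have "AE x in lborel. x \<noteq> (0::real)" by (rule AE_lborel_singleton)
    thus "AE x in lborel. ennreal (bose_kernel x * ?g x) + ennreal (x * ?g x / 2) * ?I x =
       ennreal (1 / (2 * pi)) * ennreal (?g x) * ?I x +
      (\<Sum>k. ennreal (1 / pi) * (ennreal (x\<^sup>2 * ?g x / (x\<^sup>2 + (real (Suc k))\<^sup>2)) * ?I x))"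
    proof eventually_elim
      case (elim x)
      show ?case
      proof (cases "x > 0")
        case True
        have "(\<lambda>k. ?g x * (x\<^sup>2 / (x\<^sup>2 + (real (Suc k))\<^sup>2) / pi)) sums
              (?g x * (bose_kernel x + x / 2 - 1 / (2 * pi)))" (is "?f sums ?s")
          using sums_mult[OF bose_kernel_partial_fractions[OF True]] True
          by (simp add: bose_kernel_def)
        hence "(\<Sum>k. ennreal (?f k)) = ennreal ?s"
          by (subst suminf_ennreal2) (auto simp: sums_iff)
        moreover have "?s \<ge> 0"
          by (rule sums_le[OF _ sums_zero \<open>?f sums ?s\<close>]) auto
        ultimately have "ennreal (1 / (2 * pi) * ?g x) + (\<Sum>k. ennreal (?f k)) =
            ennreal (1 / (2 * pi) * ?g x + ?s)"
          by (subst ennreal_plus) auto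
        also have "1 / (2 * pi) * ?g x + ?s = bose_kernel x * ?g x + x * ?g x / 2"
          by (simp add: algebra_simps)
        also have "ennreal \<dots> = ennreal (bose_kernel x * ?g x) + ennreal (x * ?g x / 2)"
          using True by (intro ennreal_plus) auto
        finally show ?thesis using True
          by (simp add: ennreal_mult[symmetric] mult_ac)
      qed (use elim in \<open>auto simp: bose_kernel_def\<close>)
    qed
  qed
  also have "\<dots> = (\<integral>\<^sup>+x\<in>{0..}. ennreal (1 / (2 * pi)) * ennreal (?g x) \<partial>lborel) +
     (\<integral>\<^sup>+x. (\<Sum>k. ennreal (1 / pi) * (ennreal (x\<^sup>2 * ?g x / (x\<^sup>2 + (real (Suc k))\<^sup>2)) * ?I x))
         \<partial>lborel)"
    by (intro nn_integral_add) measurable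
  also have "(\<integral>\<^sup>+x. (\<Sum>k. ennreal (1 / pi) *
      (ennreal (x\<^sup>2 * ?g x / (x\<^sup>2 + (real (Suc k))\<^sup>2)) * ?I x)) \<partial>lborel) =
     (\<Sum>k. \<integral>\<^sup>+x. ennreal (1 / pi) * (ennreal (x\<^sup>2 * ?g x / (x\<^sup>2 + (real (Suc k))\<^sup>2)) * ?I x)
         \<partial>lborel)"
    by (intro nn_integral_suminf) measurable
  also have "\<dots> =
      (\<Sum>k. ennreal (1 / pi) *
          (\<integral>\<^sup>+x. ennreal (x\<^sup>2 * ?g x / (x\<^sup>2 + (real (Suc k))\<^sup>2)) * ?I x \<partial>lborel))"
    by (intro suminf_cong nn_integral_cmult) measurable
  finally show ?thesis unfolding lin gauss by simp
qed

text \<open>For \<open>\<gamma> > 0\<close> the added term is the half-line integral of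
  \<open>x / 2 * exp (- \<gamma> * x^2)\<close>; the result is thus the Gaussian transform of
  \<open>x / 2 * coth (pi * x)\<close>.\<close>

definition completed_moment :: "real \<Rightarrow> real" where
  "completed_moment \<gamma> = bose_moment \<gamma> 0 + 1 / (4 * \<gamma>)"

text \<open>Expand the left side by partial fractions at \<open>a = sqrt \<alpha>\<close>, apply the
  Gaussian transform to each term, and resum the geometric series at
  \<open>b = sqrt \<beta>\<close>.\<close>

lemma completed_moment_reciprocity:
  fixes \<alpha> \<beta> :: real
  assumes "\<alpha> > 0" "\<beta> > 0" "\<alpha> * \<beta> = pi\<^sup>2"
  shows "completed_moment \<alpha> = \<beta> / sqrt (pi * \<alpha>) * completed_moment \<beta>"
proof -
  define a b where "a = sqrt \<alpha>" and "b = sqrt \<beta>"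
  have ab: "a > 0" "b > 0" "a * b = pi" "\<alpha> = a\<^sup>2" "\<beta> = b\<^sup>2"
    using assms by (auto simp: a_def b_def real_sqrt_mult[symmetric])
  let ?L = "\<lambda>k. \<integral>\<^sup>+x\<in>{0..}. ennreal (x * exp (- (b\<^sup>2) * x\<^sup>2) * exp (- 2 * pi * real (Suc k) * x))
      \<partial>lborel"
  have "ennreal (bose_moment \<alpha> 0) + ennreal (1 / (4 * a\<^sup>2)) =
      ennreal (1 / (4 * sqrt pi * a)) +
          (\<Sum>k. ennreal (1 / pi) * (ennreal (sqrt pi * b\<^sup>2 / a) * ?L k))"
    unfolding nn_integral_bose(1)[OF assms(1), symmetric] unfolding ab(4)
    by (subst nn_integral_bose_partial_fractions[OF ab(1)],
        subst nn_integral_gaussian_transform[OF ab(1,2) _ ab(3)]) auto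
  also have "(\<lambda>k. ennreal (1 / pi) * (ennreal (sqrt pi * b\<^sup>2 / a) * ?L k)) =
      (\<lambda>k. ennreal (b\<^sup>2 / (sqrt pi * a)) * ?L k)"
  proof -
    have "1 / pi * (sqrt pi * b\<^sup>2 / a) = b\<^sup>2 / (sqrt pi * a)"
      using ab by (simp add: field_simps flip: power2_eq_square)
    thus ?thesis using ab by (simp add: mult.assoc[symmetric] ennreal_mult[symmetric])
  qed
  also have "suminf \<dots> = ennreal (b\<^sup>2 / (sqrt pi * a)) * (\<Sum>k. ?L k)"
    by (rule ennreal_suminf_cmult)
  also have "(\<Sum>k. ?L k) = ennreal (bose_moment \<beta> 0)"
    unfolding nn_integral_bose_geometric[symmetric] using nn_integral_bose(1)[OF assms(2)] ab
    by simp
  finally have "ennreal (bose_moment \<alpha> 0 + 1 / (4 * a\<^sup>2)) =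
      ennreal (1 / (4 * sqrt pi * a) + b\<^sup>2 / (sqrt pi * a) * bose_moment \<beta> 0)"
    using nn_integral_bose(2)[OF assms(1)] nn_integral_bose(2)[OF assms(2)] ab
    by (simp add: ennreal_plus ennreal_mult[symmetric])
  hence "bose_moment \<alpha> 0 + 1 / (4 * a\<^sup>2) = 1 / (4 * sqrt pi * a) +
      b\<^sup>2 / (sqrt pi * a) * bose_moment \<beta> 0"
    using nn_integral_bose(2)[OF assms(1)] nn_integral_bose(2)[OF assms(2)] ab
    by (subst (asm) ennreal_inj) auto
  \<comment> \<open>The leftover \<open>1 / (4 * sqrt pi * a)\<close> is exactly the factor times
    \<open>1 / (4 * \<beta>)\<close>, the correction inside
    \<open>completed_moment \<beta>\<close>.\<close>
  also have "\<dots> = \<beta> / sqrt (pi * \<alpha>) * completed_moment \<beta>"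
    using ab by (simp add: completed_moment_def real_sqrt_mult field_simps)
  finally show ?thesis using ab by (simp add: completed_moment_def)
qed

subsection \<open>Taylor expansion and its relation to the hypergeometric sums\<close>

text \<open>Expand \<open>exp (- s * \<gamma> * x^2)\<close> in powers of \<open>s\<close> and
  integrate term by term, by dominated convergence of the partial sums.\<close>

lemma bose_moment_expansion:
  fixes \<gamma> s :: real
  assumes \<gamma>: "\<gamma> > 0" and s: "\<bar>s\<bar> < 1"
  shows "(\<lambda>j. \<gamma> ^ j * bose_moment \<gamma> j / fact j * (- s) ^ j) sums bose_moment (\<gamma> * (1 + s)) 0"
proof -
  define u where "u = (\<lambda>x j. (- s * \<gamma> * x\<^sup>2) ^ j / fact j)"
  have u_sums: "u x sums exp (- s * \<gamma> * x\<^sup>2)" for x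
    using exp_converges[of "- s * \<gamma> * x\<^sup>2"] by (simp add: u_def divide_inverse mult_ac)
  \<comment> \<open>The partial sums are at most
    \<open>exp (\<bar>s\<bar> * \<gamma> * x^2)\<close>; what remains of the Gaussian is still
    decaying because \<open>\<bar>s\<bar> < 1\<close>.\<close>
  define g where "g = (\<lambda>x. bose_kernel x * exp (- (\<gamma> * (1 - \<bar>s\<bar>)) * x\<^sup>2))"
  have "integrable lborel g"
    using integrable_bose[of "\<gamma> * (1 - \<bar>s\<bar>)" 0] \<gamma> s by (simp add: g_def)
  moreover have "norm (\<Sum>j<n. bose_kernel x * exp (- \<gamma> * x\<^sup>2) * u x j) \<le> g x" for n x
  proof -
    have "norm (\<Sum>j<n. u x j) \<le> (\<Sum>j<n. (\<bar>s\<bar> * \<gamma> * x\<^sup>2) ^ j / fact j)"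
      by (rule sum_norm_le) (use \<gamma> in \<open>simp add: u_def power_abs abs_mult\<close>)
    also have "\<dots> \<le> (\<Sum>j. (\<bar>s\<bar> * \<gamma> * x\<^sup>2) ^ j / fact j)"
      using \<gamma> summable_exp[of "\<bar>s\<bar> * \<gamma> * x\<^sup>2"]
      by (intro sum_le_suminf) (auto simp: divide_inverse mult_ac)
    also have "\<dots> = exp (\<bar>s\<bar> * \<gamma> * x\<^sup>2)"
      by (simp add: exp_def divide_inverse mult_ac)
    finally have "bose_kernel x * exp (- \<gamma> * x\<^sup>2) * norm (\<Sum>j<n. u x j) \<le>
        bose_kernel x * exp (- \<gamma> * x\<^sup>2) * exp (\<bar>s\<bar> * \<gamma> * x\<^sup>2)"
      by (intro mult_left_mono) auto
    also have "\<dots> = g x"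
      by (simp add: g_def mult.assoc exp_add[symmetric] algebra_simps)
    finally show ?thesis
      by (simp only: sum_distrib_left[symmetric]
          abs_mult real_norm_def abs_of_nonneg[OF bose_kernel_nonneg] abs_exp_cancel)
  qed
  moreover have "(\<lambda>n. \<Sum>j<n. bose_kernel x * exp (- \<gamma> * x\<^sup>2) * u x j) \<longlonglongrightarrow>
      bose_kernel x * exp (- (\<gamma> * (1 + s)) * x\<^sup>2)" for x
  proof -
    have "(\<lambda>j. bose_kernel x * exp (- \<gamma> * x\<^sup>2) * u x j) sums
        (bose_kernel x * exp (- \<gamma> * x\<^sup>2) * exp (- s * \<gamma> * x\<^sup>2))"
      by (intro sums_mult u_sums)
    thus ?thesis by (simp add: sums_def mult.assoc exp_add[symmetric] algebra_simps)
  qed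
  moreover have "(\<lambda>x. bose_kernel x * exp (- (\<gamma> * (1 + s)) * x\<^sup>2)) \<in> borel_measurable lborel"
    "(\<lambda>x. \<Sum>j<n. bose_kernel x * exp (- \<gamma> * x\<^sup>2) * u x j) \<in> borel_measurable lborel" for n
    unfolding u_def by measurable
  ultimately have lim: "(\<lambda>n. LINT x|lborel. (\<Sum>j<n. bose_kernel x * exp (- \<gamma> * x\<^sup>2) * u x j)) \<longlonglongrightarrow>
      (LINT x|lborel. bose_kernel x * exp (- (\<gamma> * (1 + s)) * x\<^sup>2))"
    by (intro integral_dominated_convergence[where w = g]) auto
  have term_eq: "bose_kernel x * exp (- \<gamma> * x\<^sup>2) * u x j =
      (- s) ^ j * \<gamma> ^ j / fact j * (bose_kernel x * exp (- \<gamma> * x\<^sup>2) * (x\<^sup>2) ^ j)" for x j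
    unfolding u_def power_mult_distrib by simp
  have "(LINT x|lborel. (\<Sum>j<n. bose_kernel x * exp (- \<gamma> * x\<^sup>2) * u x j)) =
      (\<Sum>j<n. \<gamma> ^ j * bose_moment \<gamma> j / fact j * (- s) ^ j)" for n
    unfolding term_eq bose_moment_def using integrable_bose[OF \<gamma>]
    by (subst Bochner_Integration.integral_sum) (auto intro!: sum.cong)
  with lim show ?thesis unfolding sums_def by (simp add: bose_moment_def)
qed

text \<open>Taylor coefficients in \<open>s\<close> of
  \<open>completed_moment (\<gamma> * (1 + s))\<close> without their sign \<open>(-1)^j\<close>; the
  constant \<open>1 / (4 * \<gamma>)\<close> comes from the geometric series of
  \<open>1 / (4 * \<gamma> * (1 + s))\<close>.\<close>

definition completed_coeff :: "real \<Rightarrow> nat \<Rightarrow> real" where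
  "completed_coeff \<gamma> j = 1 / (4 * \<gamma>) + \<gamma> ^ j * bose_moment \<gamma> j / fact j"

lemma completed_moment_expansion:
  fixes \<gamma> s :: real
  assumes \<gamma>: "\<gamma> > 0" and s: "\<bar>s\<bar> < 1"
  shows "(\<lambda>j. (- 1) ^ j * completed_coeff \<gamma> j * s ^ j) sums completed_moment (\<gamma> * (1 + s))"
proof -
  have "(\<lambda>j. 1 / (4 * \<gamma>) * (- s) ^ j + \<gamma> ^ j * bose_moment \<gamma> j / fact j * (- s) ^ j) sums
      (1 / (4 * \<gamma>) * (1 / (1 - (- s))) + bose_moment (\<gamma> * (1 + s)) 0)"
    using s by (intro sums_add sums_mult geometric_sums bose_moment_expansion assms) auto
  also have "(\<lambda>j. 1 / (4 * \<gamma>) * (- s) ^ j + \<gamma> ^ j * bose_moment \<gamma> j / fact j * (- s) ^ j) =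
      (\<lambda>j. (- 1) ^ j * completed_coeff \<gamma> j * s ^ j)"
    unfolding power_minus[of s] by (simp add: completed_coeff_def algebra_simps)
  finally show ?thesis by (simp add: completed_moment_def add.commute mult.assoc)
qed

section \<open>Terminating hypergeometric sums\<close>

lemma hyp2F1_neg_of_nat:
  "hyp2F1 (- real n) b c z =
      (\<Sum>j\<le>n. pochhammer (- real n) j * pochhammer b j / (pochhammer c j * fact j) * z ^ j)"
  unfolding hyp2F1_altdef by (rule suminf_finite) (auto simp: pochhammer_of_nat_eq_0_lemma)

lemma hyp1F1_neg_of_nat:
  "hyp1F1 (- real n) c z = (\<Sum>j\<le>n. pochhammer (- real n) j / (pochhammer c j * fact j) * z ^ j)"
  unfolding hyp1F1_altdef by (rule suminf_finite) (auto simp: pochhammer_of_nat_eq_0_lemma)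

text \<open>Both parts of \<open>J\<close> carry the weight \<open>?p j\<close>: in the Gauss
  function the Pochhammer symbol of 1 cancels \<open>fact j\<close>, in the Kummer function
  \<open>\<gamma>^j / fact j\<close> is absorbed by the moment. The prefactors agree after
  extracting \<open>1 / (4 * \<gamma>)\<close>.\<close>

lemma J_eq_sum:
  fixes \<gamma> :: real and k :: nat
  assumes \<gamma>: "\<gamma> > 0"
  defines "n \<equiv> 2 * k + 1"
  shows "J k \<gamma> = 4 * \<gamma> powr (3 / 4) *
    (\<Sum>j\<le>n. pochhammer (- real n) j / pochhammer (3 / 2) j * 2 ^ j * completed_coeff \<gamma> j)"
proof -
  let ?p = "\<lambda>j. pochhammer (- real n) j / pochhammer (3 / 2) j * 2 ^ j"
  have n: "- 2 * real k - 1 = - real n" by (simp add: n_def)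
  have "\<gamma> powr (- 1 / 4) = 4 * \<gamma> powr (3 / 4) * (1 / (4 * \<gamma>))"
    using \<gamma> powr_diff[of \<gamma> "3/4" 1] by simp
  moreover have "hyp2F1 (- real n) 1 (3 / 2) 2 = (\<Sum>j\<le>n. ?p j)"
    unfolding hyp2F1_neg_of_nat by (intro sum.cong) (auto simp: pochhammer_fact[symmetric])
  moreover have "(LINT x:{0<..}|lborel. x * exp (- \<gamma> * x\<^sup>2) / (exp (2 * pi * x) - 1)
          * hyp1F1 (- real n) (3 / 2) (2 * \<gamma> * x\<^sup>2)) =
              (\<Sum>j\<le>n. ?p j * (\<gamma> ^ j * bose_moment \<gamma> j / fact j))"
  proof -
    let ?b = "\<lambda>j x. bose_kernel x * exp (- \<gamma> * x\<^sup>2) * (x\<^sup>2) ^ j"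
    have "(LINT x:{0<..}|lborel. x * exp (- \<gamma> * x\<^sup>2) / (exp (2 * pi * x) - 1)
          * hyp1F1 (- real n) (3 / 2) (2 * \<gamma> * x\<^sup>2)) =
       (LINT x|lborel. (\<Sum>j\<le>n. ?p j * \<gamma> ^ j / fact j * ?b j x))"
      unfolding set_lebesgue_integral_def hyp1F1_neg_of_nat sum_distrib_left power_mult_distrib
      by (intro Bochner_Integration.integral_cong)
         (auto simp: bose_kernel_def indicator_def intro!: sum.cong)
    also have "\<dots> = (\<Sum>j\<le>n. ?p j * \<gamma> ^ j / fact j * bose_moment \<gamma> j)"
      unfolding bose_moment_def using integrable_bose[OF \<gamma>]
      by (subst Bochner_Integration.integral_sum) auto
    finally show ?thesis by (simp add: mult_ac)
  qed
  moreover have "(\<Sum>j\<le>n. ?p j * completed_coeff \<gamma> j) =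
      1 / (4 * \<gamma>) * (\<Sum>j\<le>n. ?p j) + (\<Sum>j\<le>n. ?p j * (\<gamma> ^ j * bose_moment \<gamma> j / fact j))"
    unfolding sum_distrib_left sum.distrib[symmetric]
    by (intro sum.cong) (simp_all add: completed_coeff_def distrib_left)
  ultimately show ?thesis unfolding J_def n by (simp only: distrib_left mult.assoc)
qed

subsection \<open>The Laguerre generating function\<close>

text \<open>The reciprocity is available only at real arguments, so expansions must be compared from
  agreement on a right neighbourhood of 0. A nonzero difference would have no zeros in a punctured
  disc around 0.\<close>

lemma fps_expansion_unique_at_right:
  fixes F G :: "complex fps"
  assumes F: "f has_fps_expansion F" and G: "g has_fps_expansion G"
    and eq: "eventually (\<lambda>t::real. f (of_real t) = g (of_real t)) (at_right 0)"
  shows "F = G"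
proof (rule ccontr)
  assume "F \<noteq> G"
  have "(\<lambda>z. f z - g z) has_fps_expansion F - G"
    by (intro fps_expansion_intros F G)
  hence "(\<lambda>z. f z - g z) has_laurent_expansion fps_to_fls (F - G)"
    by (rule has_laurent_expansion_fps)
  hence "eventually (\<lambda>z. f z - g z \<noteq> 0) (at 0)"
    using \<open>F \<noteq> G\<close> has_laurent_expansion_eventually_nonzero_iff' fps_to_fls_eq_0_iff right_minus_eq
    by blast
  moreover have "filterlim complex_of_real (at 0) (at_right 0)"
    by (rule filterlim_atI) (auto intro!: tendsto_eq_intros simp: eventually_at_filter)
  ultimately have "eventually (\<lambda>t. f (complex_of_real t) - g (of_real t) \<noteq> 0) (at_right 0)"
    by (rule eventually_compose_filterlim)
  with eq have "eventually (\<lambda>t::real. False) (at_right 0)"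
    by eventually_elim auto
  thus False by simp
qed

section \<open>Binomial series in \<open>1 - t\<close> and the Laguerre substitution\<close>

definition fps_one_minus_powr :: "complex \<Rightarrow> complex fps" where
  "fps_one_minus_powr c = fps_binomial c oo (- fps_X)"

lemma fps_one_minus_powr_nth:
  "fps_one_minus_powr (- a) $ n = pochhammer a n / fact n"
  by (simp add: fps_one_minus_powr_def fps_compose_uminus' gbinomial_pochhammer
      flip: power_add mult_2)

lemma fps_one_minus_powr_add:
  "fps_one_minus_powr (c + d) = fps_one_minus_powr c * fps_one_minus_powr d"
  by (simp add: fps_one_minus_powr_def fps_binomial_add_mult fps_compose_mult_distrib)

lemma fps_one_minus_powr_power:
  "fps_one_minus_powr c ^ n = fps_one_minus_powr (of_nat n * c)"
  by (simp add: fps_one_minus_powr_def fps_compose_power fps_binomial_power)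

lemma has_fps_expansion_one_minus_powr:
  "(\<lambda>t. (1 - t) powr c) has_fps_expansion fps_one_minus_powr c"
proof -
  have "((\<lambda>x. (1 + x) powr c) \<circ> (\<lambda>t. - t)) has_fps_expansion (fps_binomial c oo (- fps_X))"
    by (intro has_fps_expansion_compose has_fps_expansion_binomial_complex fps_expansion_intros)
        auto
  thus ?thesis by (simp add: o_def fps_one_minus_powr_def)
qed

lemma fps_compose_mult_nth:
  fixes F G H :: "'a :: comm_ring_1 fps"
  assumes "G $ 0 = 0"
  shows "((F oo G) * H) $ n = (\<Sum>j\<le>n. F $ j * (G ^ j * H) $ n)"
proof -
  have "((F oo G) * H) $ n = (\<Sum>i\<le>n. (\<Sum>j\<le>i. F $ j * (G ^ j $ i)) * H $ (n - i))"
    by (simp add: fps_mult_nth fps_compose_nth atLeast0AtMost)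
  \<comment> \<open>\<open>G ^ j\<close> starts at degree at least \<open>j\<close>, so the added
    terms with \<open>j > i\<close> vanish; the ranges become independent and can be
    swapped.\<close>
  also have "\<dots> = (\<Sum>i\<le>n. (\<Sum>j\<le>n. F $ j * (G ^ j $ i)) * H $ (n - i))"
    using startsby_zero_power_prefix[OF assms]
    by (intro sum.cong refl arg_cong2[where f = "(*)"] sum.mono_neutral_left) auto
  also have "\<dots> = (\<Sum>j\<le>n. \<Sum>i\<le>n. F $ j * (G ^ j $ i) * H $ (n - i))"
    unfolding sum_distrib_right by (rule sum.swap)
  also have "\<dots> = (\<Sum>j\<le>n. F $ j * (G ^ j * H) $ n)"
    by (simp add: fps_mult_nth sum_distrib_left atLeast0AtMost mult.assoc)
  finally show ?thesis .
qed

text \<open>Formal counterpart of \<open>F (2 * t / (1 - t)) * (1 - t) powr (- a)\<close>. The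
  substitution \<open>s = 2 * t / (1 - t)\<close> is the one with
  \<open>1 + s = (1 + t) / (1 - t)\<close>.\<close>

definition laguerre_fps :: "complex \<Rightarrow> complex fps \<Rightarrow> complex fps" where
  "laguerre_fps a F = (F oo (fps_const 2 * fps_X * fps_one_minus_powr (- 1))) *
      fps_one_minus_powr (- a)"

text \<open>The \<open>j\<close>-th power of the inner series times
  \<open>(1 - t) powr (- a)\<close> is \<open>2^j * t^j * (1 - t) powr (- (a + j))\<close>, whose
  coefficients are given by the binomial series.\<close>

lemma laguerre_fps_nth:
  "laguerre_fps a F $ n = (\<Sum>j\<le>n. F $ j * 2 ^ j * pochhammer (a + of_nat j) (n - j) / fact (n - j))"
proof -
  have "((fps_const 2 * fps_X * fps_one_minus_powr (- 1)) ^ j * fps_one_minus_powr (- a)) $ n =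
      2 ^ j * (pochhammer (a + of_nat j) (n - j) / fact (n - j))" if "j \<le> n" for j
  proof -
    have "(fps_const 2 * fps_X * fps_one_minus_powr (- 1)) ^ j * fps_one_minus_powr (- a) =
       fps_const (2 ^ j) *
           (fps_X ^ j * (fps_one_minus_powr (of_nat j * - 1) * fps_one_minus_powr (- a)))"
      by (simp only: power_mult_distrib fps_const_power fps_one_minus_powr_power mult.assoc)
    also have "fps_one_minus_powr (of_nat j * - 1) * fps_one_minus_powr (- a) =
        fps_one_minus_powr (- (a + of_nat j))"
      by (simp add: fps_one_minus_powr_add[symmetric] add.commute)
    finally show ?thesis using that fps_one_minus_powr_nth[of "a + of_nat j" "n - j"]
      by (simp add: fps_X_power_mult_nth)
  qed
  thus ?thesis unfolding laguerre_fps_def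
    by (subst fps_compose_mult_nth) (auto simp: mult.assoc intro!: sum.cong)
qed

lemma has_fps_expansion_laguerre:
  assumes "f has_fps_expansion F"
  shows "(\<lambda>t. f (2 * t * (1 - t) powr (- 1)) * (1 - t) powr (- a))
      has_fps_expansion laguerre_fps a F"
proof -
  have "(f \<circ> (\<lambda>t. 2 * t * (1 - t) powr (- 1))) has_fps_expansion
      (F oo (fps_const 2 * fps_X * fps_one_minus_powr (- 1)))"
    by (intro has_fps_expansion_compose assms fps_expansion_intros
        has_fps_expansion_one_minus_powr) auto
  from has_fps_expansion_mult[OF this has_fps_expansion_one_minus_powr[of "- a"]] show ?thesis
    by (simp add: o_def laguerre_fps_def)
qed

text \<open>Real coefficients, placed in the complex numbers so that uniqueness of analytic
  expansions applies.\<close>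

definition completed_fps :: "real \<Rightarrow> complex fps" where
  "completed_fps \<gamma> = Abs_fps (\<lambda>j. of_real ((- 1) ^ j * completed_coeff \<gamma> j))"

lemma completed_fps_sums:
  assumes "\<gamma> > 0" "\<bar>s\<bar> < 1"
  shows "(\<lambda>j. completed_fps \<gamma> $ j * of_real s ^ j) sums of_real (completed_moment (\<gamma> * (1 + s)))"
  using sums_of_real[OF completed_moment_expansion[OF assms], where 'a = complex]
  by (simp add: completed_fps_def)

lemma eval_completed_fps:
  assumes "\<gamma> > 0" "\<bar>s\<bar> < 1"
  shows "eval_fps (completed_fps \<gamma>) (of_real s) = of_real (completed_moment (\<gamma> * (1 + s)))"
  unfolding eval_fps_def using completed_fps_sums[OF assms] by (simp add: sums_iff)

lemma has_fps_expansion_completed: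
  assumes "\<gamma> > 0"
  shows "eval_fps (completed_fps \<gamma>) has_fps_expansion completed_fps \<gamma>"
proof -
  \<comment> \<open>Convergence at the single point \<open>1 / 2\<close> already gives a positive
    radius; any nonzero \<open>s\<close> with \<open>\<bar>s\<bar> < 1\<close> would serve.\<close>
  have "0 < ereal (norm (complex_of_real (1 / 2)))" by simp
  also have "\<dots> \<le> fps_conv_radius (completed_fps \<gamma>)"
    unfolding fps_conv_radius_def
    using sums_summable[OF completed_fps_sums[OF assms, of "1/2"]] by (intro conv_radius_geI) simp
  finally show ?thesis by (simp add: has_fps_expansion_def)
qed

text \<open>At real points the complex powers are real. The bound \<open>1 / 4\<close> lies below
  \<open>1 / 3\<close>, which keeps \<open>2 * t / (1 - t)\<close> inside the unit disc.\<close>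

lemma laguerre_completed_of_real:
  assumes "\<gamma> > 0" "\<bar>t\<bar> < 1 / 4"
  shows "eval_fps (completed_fps \<gamma>) (2 * of_real t * (1 - of_real t) powr (- 1)) *
      (1 - of_real t) powr (- 3 / 2) =
    of_real ((1 - t) powr (- 3 / 2) * completed_moment (\<gamma> * ((1 + t) / (1 - t))))"
proof -
  have t: "1 - t > 0" "1 - t > 3 / 4" "2 * \<bar>t\<bar> < 3 / 4" using assms(2) by auto
  have pow: "(1 - complex_of_real t) powr of_real c = of_real ((1 - t) powr c)" for c
    using powr_of_real[of "1 - t" c] t by simp
  have "2 * of_real t * (1 - complex_of_real t) powr (- 1) = of_real (2 * t / (1 - t))"
    using pow[of "- 1"] t by (simp add: powr_minus_divide)
  moreover have "\<bar>2 * t / (1 - t)\<bar> < 1"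
  proof -
    have "2 * \<bar>t\<bar> < 1 - t" using t by linarith
    thus ?thesis using t by (simp add: abs_mult)
  qed
  moreover have "1 + 2 * t / (1 - t) = (1 + t) / (1 - t)"
    using t by (simp add: field_simps)
  ultimately show ?thesis
    using eval_completed_fps[OF assms(1), of "2 * t / (1 - t)"] pow[of "- 3 / 2"] by simp
qed

text \<open>The two arguments again multiply to \<open>pi^2\<close>, so reciprocity applies. Its
  factor gains \<open>((1 - t) / (1 + t)) powr (3 / 2)\<close>, which converts
  \<open>(1 - t) powr (- 3 / 2)\<close> into \<open>(1 + t) powr (- 3 / 2)\<close>; this fixes the
  parameter \<open>3 / 2\<close>.\<close>

lemma completed_moment_moebius:
  assumes "\<alpha> > 0" "\<beta> > 0" "\<alpha> * \<beta> = pi\<^sup>2" "\<bar>t\<bar> < 1"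
  shows "(1 - t) powr (- 3 / 2) * completed_moment (\<alpha> * ((1 + t) / (1 - t))) =
    \<beta> / sqrt (pi * \<alpha>) * ((1 + t) powr (- 3 / 2) * completed_moment (\<beta> * ((1 - t) / (1 + t))))"
proof -
  define p q where "p = 1 - t" and "q = 1 + t"
  have pq: "p > 0" "q > 0" using assms(4) by (auto simp: p_def q_def)
  have pow: "x powr (- 3 / 2) = 1 / (x * sqrt x)" if "x > 0" for x :: real
  proof -
    have "x powr (3 / 2) = x powr 1 * x powr (1 / 2)" using powr_add[of x 1 "1 / 2"] by simp
    thus ?thesis using that by (simp add: powr_minus_divide powr_half_sqrt)
  qed
  have "completed_moment (\<alpha> * (q / p)) = \<beta> * (p / q) / sqrt (pi * (\<alpha> * (q / p))) *
      completed_moment (\<beta> * (p / q))"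
    using assms pq by (intro completed_moment_reciprocity) auto
  hence "p powr (- 3 / 2) * completed_moment (\<alpha> * (q / p)) =
    (p powr (- 3 / 2) * (\<beta> * (p / q) / sqrt (pi * (\<alpha> * (q / p))))) * completed_moment (\<beta> * (p / q))"
    by simp
  also have "p powr (- 3 / 2) * (\<beta> * (p / q) / sqrt (pi * (\<alpha> * (q / p)))) =
      \<beta> / sqrt (pi * \<alpha>) * q powr (- 3 / 2)"
    unfolding pow[OF pq(1)] pow[OF pq(2)]
    using pq assms by (simp add: real_sqrt_mult real_sqrt_divide field_simps)
  finally show ?thesis by (simp add: p_def q_def mult_ac)
qed

text \<open>For small positive \<open>t\<close> the generating functions satisfy
  \<open>?K \<alpha> t = ?c * ?K \<beta> (- t)\<close>; comparing coefficients produces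
  \<open>(-1)^n\<close>.\<close>

lemma laguerre_completed_reciprocity:
  assumes "\<alpha> > 0" "\<beta> > 0" "\<alpha> * \<beta> = pi\<^sup>2"
  shows "laguerre_fps (3 / 2) (completed_fps \<alpha>) $ n =
    of_real (\<beta> / sqrt (pi * \<alpha>)) * (- 1) ^ n * laguerre_fps (3 / 2) (completed_fps \<beta>) $ n"
proof -
  let ?K = "\<lambda>\<gamma> t. eval_fps (completed_fps \<gamma>) (2 * t * (1 - t) powr (- 1)) *
      (1 - t) powr (- (3 / 2))"
  let ?c = "complex_of_real (\<beta> / sqrt (pi * \<alpha>))"
  have K: "?K \<gamma> has_fps_expansion laguerre_fps (3 / 2) (completed_fps \<gamma>)" if "\<gamma> > 0" for \<gamma>
    by (intro has_fps_expansion_laguerre has_fps_expansion_completed that)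
  have "(?K \<beta> \<circ> (\<lambda>t. - t)) has_fps_expansion (laguerre_fps (3 / 2) (completed_fps \<beta>) oo (- fps_X))"
    by (intro has_fps_expansion_compose K assms fps_expansion_intros) auto
  hence "(\<lambda>t. ?c * ?K \<beta> (- t)) has_fps_expansion fps_const ?c *
      (laguerre_fps (3 / 2) (completed_fps \<beta>) oo (- fps_X))"
    unfolding o_def by (intro fps_expansion_intros)
  moreover have "eventually (\<lambda>t. ?K \<alpha> (of_real t) = ?c * ?K \<beta> (- of_real t)) (at_right 0)"
  proof -
    have "eventually (\<lambda>t::real. t \<in> {0<..<1 / 4}) (at_right 0)"
      by (rule eventually_at_right_real) simp
    thus ?thesis
    proof eventually_elim
      case (elim t)
      hence t: "\<bar>t\<bar> < 1 / 4" "\<bar>- t\<bar> < 1 / 4" "\<bar>t\<bar> < 1" by auto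
      let ?L = "\<lambda>\<gamma> t. (1 - t) powr (- 3 / 2) * completed_moment (\<gamma> * ((1 + t) / (1 - t)))"
      have "?K \<alpha> (of_real t) = of_real (?L \<alpha> t)"
        using laguerre_completed_of_real[OF assms(1) t(1)] by simp
      also have "?L \<alpha> t = \<beta> / sqrt (pi * \<alpha>) * ?L \<beta> (- t)"
        using completed_moment_moebius[OF assms t(3)] by simp
      also have "of_real \<dots> = ?c * ?K \<beta> (of_real (- t))"
        unfolding of_real_mult[of "\<beta> / sqrt (pi * \<alpha>)"]
        using laguerre_completed_of_real[OF assms(2) t(2)] by simp
      finally show ?case by simp
    qed
  qed
  ultimately have "laguerre_fps (3 / 2) (completed_fps \<alpha>) =
      fps_const ?c * (laguerre_fps (3 / 2) (completed_fps \<beta>) oo (- fps_X))"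
    by (intro fps_expansion_unique_at_right[OF K[OF assms(1)]])
  thus ?thesis by (simp add: fps_compose_uminus')
qed

text \<open>Identifies the coefficient with the sum in \<open>J_eq_sum\<close> up to a factor
  depending only on \<open>n\<close>: \<open>(-1)^j * fact n / fact (n - j)\<close> is the
  Pochhammer symbol of \<open>- n\<close>, and that of \<open>3 / 2\<close> splits at
  \<open>j\<close>.\<close>

lemma laguerre_completed_nth:
  "laguerre_fps (3 / 2) (completed_fps \<gamma>) $ n = of_real (pochhammer (3 / 2) n / fact n *
    (\<Sum>j\<le>n. pochhammer (- real n) j / pochhammer (3 / 2) j * 2 ^ j * completed_coeff \<gamma> j))"
proof -
  have "(- 1) ^ j * completed_coeff \<gamma> j * 2 ^ j * pochhammer (3 / 2 + real j) (n - j) /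
      fact (n - j) =
    pochhammer (3 / 2) n / fact n *
        (pochhammer (- real n) j / pochhammer (3 / 2) j * 2 ^ j * completed_coeff \<gamma> j)"
    if "j \<le> n" for j
  proof -
    have "real (n choose j) = (- 1) ^ j * pochhammer (- real n) j / fact j"
      unfolding binomial_gbinomial gbinomial_pochhammer by simp
    hence "pochhammer (- real n) j = (- 1) ^ j * (fact n / fact (n - j))"
      using that by (simp add: binomial_fact field_simps flip: power_add mult_2)
    moreover have "pochhammer (3 / 2 :: real) n =
        pochhammer (3 / 2) j * pochhammer (3 / 2 + real j) (n - j)"
      using that by (rule pochhammer_product)
    moreover have "pochhammer (3 / 2 :: real) j \<noteq> 0"
      by (simp add: pochhammer_pos less_imp_neq[THEN not_sym])
    ultimately show ?thesis by simp
  qed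
  hence "(\<Sum>j\<le>n. (- 1) ^ j * completed_coeff \<gamma> j * 2 ^ j * pochhammer (3 / 2 + real j) (n - j) /
      fact (n - j)) =
     pochhammer (3 / 2) n / fact n *
    (\<Sum>j\<le>n. pochhammer (- real n) j / pochhammer (3 / 2) j * 2 ^ j * completed_coeff \<gamma> j)"
    unfolding sum_distrib_left by (intro sum.cong) auto
  moreover have "laguerre_fps (3 / 2) (completed_fps \<gamma>) $ n = of_real
     (\<Sum>j\<le>n. (- 1) ^ j * completed_coeff \<gamma> j * 2 ^ j * pochhammer (3 / 2 + real j) (n - j) /
         fact (n - j))"
    unfolding laguerre_fps_nth by (simp add: completed_fps_def flip: pochhammer_of_real)
  ultimately show ?thesis by simp
qed

section \<open>Odd Laguerre coefficients and the matching of the prefactors\<close>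

theorem theorem1p7:
  fixes \<alpha> \<beta> :: real and k :: nat
  assumes "\<alpha> > 0" and "\<beta> > 0" and "\<alpha> * \<beta> = pi\<^sup>2"
  shows "J k \<alpha> = - J k \<beta>"
proof -
  define n where "n = 2 * k + 1"
  define S where "S =
      (\<lambda>\<gamma>. \<Sum>j\<le>n. pochhammer (- real n) j / pochhammer (3 / 2) j * 2 ^ j * completed_coeff \<gamma> j)"
  have J: "J k \<gamma> = 4 * \<gamma> powr (3 / 4) * S \<gamma>" if "\<gamma> > 0" for \<gamma>
    using J_eq_sum[OF that, of k] by (simp add: S_def n_def)
  \<comment> \<open>The minus sign of the claim comes from \<open>n = 2 * k + 1\<close> being
    odd.\<close>
  have "(- 1) ^ n = (- 1 :: complex)" by (simp add: n_def)
  hence "complex_of_real (pochhammer (3 / 2) n / fact n * S \<alpha>) =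
      of_real (- (\<beta> / sqrt (pi * \<alpha>) * (pochhammer (3 / 2) n / fact n * S \<beta>)))"
    using laguerre_completed_reciprocity[OF assms, of n]
    unfolding laguerre_completed_nth S_def by simp
  hence "pochhammer (3 / 2) n / fact n * S \<alpha> =
      pochhammer (3 / 2) n / fact n * (- (\<beta> / sqrt (pi * \<alpha>) * S \<beta>))"
    unfolding of_real_eq_iff by (simp add: mult_ac)
  moreover have "pochhammer (3 / 2) n / fact n \<noteq> (0 :: real)"
    by (simp add: pochhammer_pos less_imp_neq[THEN not_sym])
  ultimately have S: "S \<alpha> = - (\<beta> / sqrt (pi * \<alpha>) * S \<beta>)"
    using mult_left_cancel by blast
  \<comment> \<open>Eliminating \<open>pi\<close> gives \<open>sqrt (pi * \<alpha>) = \<alpha> powr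
    (3 / 4) * \<beta> powr (1 / 4)\<close>, so the prefactor of \<open>J k \<alpha>\<close> times
    the reciprocity factor is that of \<open>J k \<beta>\<close>.\<close>
  have "pi = (\<alpha> * \<beta>) powr (1 / 2)"
    unfolding assms(3) by (simp add: powr_half_sqrt)
  hence "sqrt (pi * \<alpha>) = ((\<alpha> * \<beta>) powr (1 / 2) * \<alpha> powr 1) powr (1 / 2)"
    using assms by (simp add: powr_half_sqrt)
  also have "\<dots> = \<alpha> powr (1 / 4) * \<alpha> powr (1 / 2) * \<beta> powr (1 / 4)"
    using assms(1,2) by (simp add: powr_mult powr_powr mult_ac)
  also have "\<alpha> powr (1 / 4) * \<alpha> powr (1 / 2) = \<alpha> powr (3 / 4)"
    by (simp flip: powr_add)
  finally have "\<alpha> powr (3 / 4) * (\<beta> / sqrt (pi * \<alpha>)) = \<beta> powr 1 / \<beta> powr (1 / 4)"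
    using assms by simp
  also have "\<dots> = \<beta> powr (3 / 4)" by (simp only: powr_diff[symmetric]) simp
  finally have key: "\<alpha> powr (3 / 4) * (\<beta> / sqrt (pi * \<alpha>)) = \<beta> powr (3 / 4)" .
  have "4 * \<alpha> powr (3 / 4) * S \<alpha> = - (4 * (\<alpha> powr (3 / 4) * (\<beta> / sqrt (pi * \<alpha>))) * S \<beta>)"
    unfolding S by simp
  hence "4 * \<alpha> powr (3 / 4) * S \<alpha> = - (4 * \<beta> powr (3 / 4) * S \<beta>)"
    unfolding key .
  thus ?thesis
    unfolding J[OF assms(1)] J[OF assms(2)] .
qed

end
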